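(* Let $(X_1,d_1)$, $(X_2,d_2)$ be a pair of disjoint semimetric spaces satisfying the $K_1$-relaxed polygonal inequality and the $K_2$-relaxed polygonal inequality respectively, where $K_1,K_2\geqslant 1$. Assume that $\operatorname{diam}_{d_1}(X_1)=r_1<\infty$ and $\operatorname{diam}_{d_2}(X_2)=r_2<\infty$. Let $X:=X_1\cup X_2$. Then there exists an extension $d:X\times X\to[0,+\infty)$ of $d_1$ and $d_2$ (that is, $d|_{X_i\times X_i}=d_i$ for $i=1,2$) which satisfies the $K$-relaxed polygonal inequality, where $K:=\max\{K_1,K_2\}$. Additionally, $\operatorname{diam}_d(X)=\max\{r_1,r_2\}$.
   Context: A semimetric space is a non-empty set $X$ with a function $d:X\times X\to[0,+\infty)$ (a semimetric) such that for all $x,y\in X$: $d(x,y)=0$ iff $x=y$, and $d(x,y)=d(y,x)$. For a fixed $K\geqslant 1$, a semimetric space $(X,d)$ satisfies the $K$-relaxed polygonal inequality if $d(x_0,x_n)\leqslant K\sum_{i=1}^n d(x_{i-1},x_i)$ for any $n\in\mathbb{N}$ and $x_0,x_1,\dots,x_n\in X$. The diameter of $A\subset X$ is $\operatorname{diam}_d(A):=\sup\{d(x,y): x,y\in A\}$.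
   Formalization: If the extension d is to be a semimetric, the diameter equality is claimed only when max{r_1,r_2} is nonzero (it fails when X_1 and X_2 are both single points); for d merely a nonnegative function it is proved in every case. *)

theory Defs
  imports Complex_Main "HOL-Library.Extended_Real"
begin

definition nonneg_on :: "'a set \<Rightarrow> ('a \<Rightarrow> 'a \<Rightarrow> real) \<Rightarrow> bool" where
  "nonneg_on X d \<longleftrightarrow> (\<forall>x\<in>X. \<forall>y\<in>X. 0 \<le> d x y)"

text \<open>Spaces are carrier sets; the values of \<open>d\<close> outside \<open>X \<times> X\<close> are irrelevant.\<close>

definition semimetric_space :: "'a set \<Rightarrow> ('a \<Rightarrow> 'a \<Rightarrow> real) \<Rightarrow> bool" where
  "semimetric_space X d \<longleftrightarrow>
     X \<noteq> {} \<and> nonneg_on X d \<and>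
     (\<forall>x\<in>X. \<forall>y\<in>X. d x y = 0 \<longleftrightarrow> x = y) \<and>
     (\<forall>x\<in>X. \<forall>y\<in>X. d x y = d y x)"

definition relaxed_polygonal :: "real \<Rightarrow> 'a set \<Rightarrow> ('a \<Rightarrow> 'a \<Rightarrow> real) \<Rightarrow> bool" where
  "relaxed_polygonal K X d \<longleftrightarrow>
     (\<forall>(n::nat) (x::nat \<Rightarrow> 'a). (\<forall>i\<le>n. x i \<in> X) \<longrightarrow>
        d (x 0) (x n) \<le> K * (\<Sum>i=1..n. d (x (i - 1)) (x i)))"

text \<open>The diameter takes values in the extended reals, so that
  \<open>sdiam d A = ereal r\<close> (with \<open>r\<close> real) includes its finiteness.\<close>

definition sdiam :: "('a \<Rightarrow> 'a \<Rightarrow> real) \<Rightarrow> 'a set \<Rightarrow> ereal" where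
  "sdiam d A = Sup {ereal (d x y) | x y. x \<in> A \<and> y \<in> A}"

definition extends_on :: "'a set \<Rightarrow> ('a \<Rightarrow> 'a \<Rightarrow> real) \<Rightarrow> ('a \<Rightarrow> 'a \<Rightarrow> real) \<Rightarrow> bool" where
  "extends_on A d' d \<longleftrightarrow> (\<forall>x\<in>A. \<forall>y\<in>A. d x y = d' x y)"

text \<open>When \<open>X\<^sub>1\<close> and \<open>X\<^sub>2\<close> are both singletons, \<open>r\<^sub>1 = r\<^sub>2 = 0\<close>, and no semimetric on the
  two-point union has diameter \<open>max r\<^sub>1 r\<^sub>2 = 0\<close>. The theorem therefore makes two claims: a
  semimetric extension always exists, with the stated diameter except in that case; and
  an extension that is merely a nonnegative function, with the stated diameter, exists
  in every case.\<close>

end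

theory Submission
  imports Defs
begin

text \<open>
  Put every point of \<open>X\<^sub>1\<close> at one common distance \<open>c\<close> from every point of \<open>X\<^sub>2\<close>, where \<open>c\<close> is at
  least both diameters. A chain that stays in one part is controlled by the polygonal inequality
  of that part. A chain that visits both parts contains a step of length \<open>c\<close>, and no two points of
  the union are further apart than \<open>c\<close>; so that single step already gives the inequality, even
  with the constant \<open>1\<close> (lemma \<open>relaxed_polygonal_glue\<close>).

  With \<open>c = max r\<^sub>1 r\<^sub>2\<close> no distance exceeds the larger diameter, and the part where it is attained
  as a supremum is contained in the union (lemma \<open>sdiam_glue\<close>). The glued function separates
  points exactly when \<open>c > 0\<close>, so a semimetric is obtained with this \<open>c\<close> unless both spaces are
  singletons; in that case \<open>c = 1\<close> is used instead.
\<close>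

definition glue :: "'a set \<Rightarrow> real \<Rightarrow> ('a \<Rightarrow> 'a \<Rightarrow> real) \<Rightarrow> ('a \<Rightarrow> 'a \<Rightarrow> real) \<Rightarrow> 'a \<Rightarrow> 'a \<Rightarrow> real" where
  "glue A c d1 d2 x y =
     (if x \<in> A \<and> y \<in> A then d1 x y else if x \<notin> A \<and> y \<notin> A then d2 x y else c)"

lemma extends_on_glue_left: "extends_on A d1 (glue A c d1 d2)"
  by (simp add: extends_on_def glue_def)

lemma extends_on_glue_right: "A \<inter> B = {} \<Longrightarrow> extends_on B d2 (glue A c d1 d2)"
  by (auto simp: extends_on_def glue_def)

lemma nonneg_on_glue:
  assumes "nonneg_on A d1" "nonneg_on B d2" "0 \<le> c"
  shows "nonneg_on (A \<union> B) (glue A c d1 d2)"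
  using assms by (auto simp: nonneg_on_def glue_def)

lemma semimetric_space_glue:
  assumes "semimetric_space A d1" "semimetric_space B d2" "0 < c"
  shows "semimetric_space (A \<union> B) (glue A c d1 d2)"
proof -
  have "nonneg_on (A \<union> B) (glue A c d1 d2)"
    using assms by (intro nonneg_on_glue) (auto simp: semimetric_space_def)
  then show ?thesis
    using assms by (auto simp: semimetric_space_def glue_def)
qed

lemma glue_le:
  assumes "\<And>x y. x \<in> A \<Longrightarrow> y \<in> A \<Longrightarrow> d1 x y \<le> c"
    and "\<And>x y. x \<in> B \<Longrightarrow> y \<in> B \<Longrightarrow> d2 x y \<le> c"
    and "x \<in> A \<union> B" "y \<in> A \<union> B"
  shows "glue A c d1 d2 x y \<le> c"
  using assms by (auto simp: glue_def)

lemma relaxed_polygonal_mono: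
  assumes "relaxed_polygonal K X d" "nonneg_on X d" "K \<le> L"
  shows "relaxed_polygonal L X d"
  unfolding relaxed_polygonal_def
proof (intro allI impI)
  fix n and x :: "nat \<Rightarrow> 'a"
  assume x: "\<forall>i\<le>n. x i \<in> X"
  let ?S = "\<Sum>i=1..n. d (x (i - 1)) (x i)"
  have "0 \<le> ?S"
    using assms(2) x by (intro sum_nonneg) (auto simp: nonneg_on_def)
  then have "K * ?S \<le> L * ?S"
    by (intro mult_right_mono assms(3))
  moreover have "d (x 0) (x n) \<le> K * ?S"
    using assms(1) x unfolding relaxed_polygonal_def by blast
  ultimately show "d (x 0) (x n) \<le> L * ?S"
    by linarith
qed

lemma relaxed_polygonal_cong:
  assumes "extends_on X d' d"
  shows "relaxed_polygonal K X d \<longleftrightarrow> relaxed_polygonal K X d'"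
proof -
  have "d (x 0) (x n) \<le> K * (\<Sum>i=1..n. d (x (i - 1)) (x i)) \<longleftrightarrow>
      d' (x 0) (x n) \<le> K * (\<Sum>i=1..n. d' (x (i - 1)) (x i))"
    if x: "\<forall>i\<le>n. x i \<in> X" for n :: nat and x
  proof -
    have "d (x 0) (x n) = d' (x 0) (x n)"
      using assms x by (auto simp: extends_on_def)
    moreover have "(\<Sum>i=1..n. d (x (i - 1)) (x i)) = (\<Sum>i=1..n. d' (x (i - 1)) (x i))"
      using assms x by (intro sum.cong) (auto simp: extends_on_def)
    ultimately show ?thesis
      by presburger
  qed
  then show ?thesis
    unfolding relaxed_polygonal_def by blast
qed

lemma crossing_step:
  fixes x :: "nat \<Rightarrow> 'a"
  assumes "k \<le> n" and "(x k \<in> A) \<noteq> (x 0 \<in> A)"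
  obtains i where "i \<in> {1..n}" and "(x (i - 1) \<in> A) \<noteq> (x i \<in> A)"
proof -
  have "\<exists>i\<in>{1..k}. (x (i - 1) \<in> A) \<noteq> (x i \<in> A)"
    using assms(2)
  proof (induction k)
    case (Suc k)
    show ?case
    proof (cases "(x k \<in> A) = (x (Suc k) \<in> A)")
      case True
      then show ?thesis using Suc by fastforce
    next
      case False
      then show ?thesis by (intro bexI[of _ "Suc k"]) auto
    qed
  qed simp
  then obtain i where i: "i \<in> {1..k}" "(x (i - 1) \<in> A) \<noteq> (x i \<in> A)"
    by blast
  show ?thesis
    using i assms(1) by (intro that[of i]) auto
qed

text \<open>A chain either stays in one part, where the inequality is inherited, or makes a step of
  length \<open>c\<close>, which bounds every distance in the union.\<close>

lemma relaxed_polygonal_glue: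
  assumes disj: "A \<inter> B = {}" and K: "1 \<le> K" and c: "0 \<le> c"
    and nonneg: "nonneg_on A d1" "nonneg_on B d2"
    and poly: "relaxed_polygonal K A d1" "relaxed_polygonal K B d2"
    and le1: "\<And>x y. x \<in> A \<Longrightarrow> y \<in> A \<Longrightarrow> d1 x y \<le> c"
    and le2: "\<And>x y. x \<in> B \<Longrightarrow> y \<in> B \<Longrightarrow> d2 x y \<le> c"
  shows "relaxed_polygonal K (A \<union> B) (glue A c d1 d2)"
  unfolding relaxed_polygonal_def
proof (intro allI impI)
  fix n and x :: "nat \<Rightarrow> 'a"
  let ?d = "glue A c d1 d2"
  let ?S = "\<Sum>i=1..n. ?d (x (i - 1)) (x i)"
  assume x: "\<forall>i\<le>n. x i \<in> A \<union> B"
  consider (left) "\<forall>i\<le>n. x i \<in> A" | (right) "\<forall>i\<le>n. x i \<in> B"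
    | (cross) k where "k \<le> n" "(x k \<in> A) \<noteq> (x 0 \<in> A)"
    using x disj by blast
  then show "?d (x 0) (x n) \<le> K * ?S"
  proof cases
    case left
    have "relaxed_polygonal K A ?d"
      using poly(1) relaxed_polygonal_cong[OF extends_on_glue_left] by blast
    with left show ?thesis unfolding relaxed_polygonal_def by blast
  next
    case right
    have "relaxed_polygonal K B ?d"
      using poly(2) relaxed_polygonal_cong[OF extends_on_glue_right[OF disj]] by blast
    with right show ?thesis unfolding relaxed_polygonal_def by blast
  next
    case cross
    then obtain i where i: "i \<in> {1..n}" "(x (i - 1) \<in> A) \<noteq> (x i \<in> A)"
      by (rule crossing_step)
    have steps: "0 \<le> ?d (x (j - 1)) (x j)" if "j \<in> {1..n}" for j
      using nonneg_on_glue[OF nonneg c] x that by (auto simp: nonneg_on_def)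
    have sum: "0 \<le> ?S"
      using steps by (intro sum_nonneg)
    have "?d (x 0) (x n) \<le> c"
      using x by (intro glue_le[OF le1 le2]) auto
    also have "c = ?d (x (i - 1)) (x i)"
      using i(2) by (auto simp: glue_def)
    also have "\<dots> \<le> ?S"
      using i(1) steps by (intro member_le_sum) auto
    also have "\<dots> \<le> K * ?S"
      using mult_right_mono[OF K sum] by simp
    finally show ?thesis .
  qed
qed

lemma sdiam_upper: "x \<in> A \<Longrightarrow> y \<in> A \<Longrightarrow> ereal (d x y) \<le> sdiam d A"
  unfolding sdiam_def by (rule Sup_upper) blast

lemma sdiam_least: "(\<And>x y. x \<in> A \<Longrightarrow> y \<in> A \<Longrightarrow> ereal (d x y) \<le> r) \<Longrightarrow> sdiam d A \<le> r"
  unfolding sdiam_def by (rule Sup_least) blast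

lemma sdiam_le_extension:
  assumes "extends_on A d' d" "A \<subseteq> X"
  shows "sdiam d' A \<le> sdiam d X"
proof (rule sdiam_least)
  fix x y assume "x \<in> A" "y \<in> A"
  then show "ereal (d' x y) \<le> sdiam d X"
    using assms sdiam_upper[of x X y d] by (auto simp: extends_on_def)
qed

lemma sdiam_glue:
  assumes disj: "A \<inter> B = {}"
    and diam: "sdiam d1 A = ereal r1" "sdiam d2 B = ereal r2"
  shows "sdiam (glue A (max r1 r2) d1 d2) (A \<union> B) = ereal (max r1 r2)"
proof (rule antisym)
  let ?c = "max r1 r2"
  have "d1 x y \<le> ?c" if "x \<in> A" "y \<in> A" for x y
    using sdiam_upper[OF that, of d1] diam by simp
  moreover have "d2 x y \<le> ?c" if "x \<in> B" "y \<in> B" for x y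
    using sdiam_upper[OF that, of d2] diam by simp
  ultimately show "sdiam (glue A ?c d1 d2) (A \<union> B) \<le> ereal ?c"
    by (intro sdiam_least) (simp only: ereal_less_eq, rule glue_le)
  have "sdiam d1 A \<le> sdiam (glue A ?c d1 d2) (A \<union> B)"
    by (intro sdiam_le_extension extends_on_glue_left) simp
  moreover have "sdiam d2 B \<le> sdiam (glue A ?c d1 d2) (A \<union> B)"
    by (intro sdiam_le_extension extends_on_glue_right disj) simp
  ultimately show "ereal ?c \<le> sdiam (glue A ?c d1 d2) (A \<union> B)"
    unfolding diam by (cases "r1 \<le> r2") (simp_all add: max_absorb1 max_absorb2)
qed

theorem lemma5p2:
  fixes X1 X2 :: "'a set" and d1 d2 :: "'a \<Rightarrow> 'a \<Rightarrow> real"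
    and K1 K2 r1 r2 :: real
  assumes "semimetric_space X1 d1" and "semimetric_space X2 d2"
    and "X1 \<inter> X2 = {}"
    and "K1 \<ge> 1" and "K2 \<ge> 1"
    and "relaxed_polygonal K1 X1 d1" and "relaxed_polygonal K2 X2 d2"
    and "sdiam d1 X1 = ereal r1" and "sdiam d2 X2 = ereal r2"
  shows "(\<exists>d. semimetric_space (X1 \<union> X2) d \<and>
              extends_on X1 d1 d \<and> extends_on X2 d2 d \<and>
              relaxed_polygonal (max K1 K2) (X1 \<union> X2) d \<and>
              (max r1 r2 \<noteq> 0 \<longrightarrow> sdiam d (X1 \<union> X2) = ereal (max r1 r2))) \<and>
         (\<exists>d. nonneg_on (X1 \<union> X2) d \<and>
              extends_on X1 d1 d \<and> extends_on X2 d2 d \<and>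
              relaxed_polygonal (max K1 K2) (X1 \<union> X2) d \<and>
              sdiam d (X1 \<union> X2) = ereal (max r1 r2))"
proof -
  have le1: "d1 x y \<le> r1" if "x \<in> X1" "y \<in> X1" for x y
    using sdiam_upper[OF that, of d1] assms(8) by simp
  have le2: "d2 x y \<le> r2" if "x \<in> X2" "y \<in> X2" for x y
    using sdiam_upper[OF that, of d2] assms(9) by simp
  have nonneg: "nonneg_on X1 d1" "nonneg_on X2 d2"
    using assms(1,2) by (auto simp: semimetric_space_def)
  obtain a where "a \<in> X1"
    using assms(1) by (auto simp: semimetric_space_def)
  then have "0 \<le> r1"
    using le1[of a a] nonneg(1) unfolding nonneg_on_def by force
  then have max_nonneg: "0 \<le> max r1 r2"
    by simp
  have poly: "relaxed_polygonal (max K1 K2) (X1 \<union> X2) (glue X1 c d1 d2)"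
    if "max r1 r2 \<le> c" for c
  proof (rule relaxed_polygonal_glue[OF assms(3)])
    show "relaxed_polygonal (max K1 K2) X1 d1" "relaxed_polygonal (max K1 K2) X2 d2"
      using assms(6,7) nonneg by (auto intro: relaxed_polygonal_mono)
  qed (use assms(4) nonneg max_nonneg that le1 le2 in \<open>force+\<close>)
  note extends = extends_on_glue_left extends_on_glue_right[OF assms(3)]
  note diam = sdiam_glue[OF assms(3) assms(8,9)]
  let ?c = "if max r1 r2 = 0 then 1 else max r1 r2"
  have "semimetric_space (X1 \<union> X2) (glue X1 ?c d1 d2)"
    using max_nonneg by (intro semimetric_space_glue assms(1,2)) auto
  moreover have "relaxed_polygonal (max K1 K2) (X1 \<union> X2) (glue X1 ?c d1 d2)"
    by (cases "max r1 r2 = 0") (simp_all add: poly del: max.bounded_iff)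
  moreover have "max r1 r2 \<noteq> 0 \<longrightarrow> sdiam (glue X1 ?c d1 d2) (X1 \<union> X2) = ereal (max r1 r2)"
    using diam by simp
  moreover have "nonneg_on (X1 \<union> X2) (glue X1 (max r1 r2) d1 d2)"
    by (rule nonneg_on_glue[OF nonneg max_nonneg])
  ultimately show ?thesis
    using extends poly[OF order_refl] diam by blast
qed

end
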